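(* Let $V$ be an infinite dimensional complex vector space and let $\mathfrak{g}$ be the quadratic Lie algebra of finite rank linear operators of $V$, with the commutator bracket and invariant bilinear form $B(X,Y)=\mathrm{Tr}(XY)$. Then the natural map $\Theta^*\colon H^1_c(\mathfrak{g})\to H^2(\mathfrak{g})$ is not one to one.
   Context: $\mathrm{Tr}$ is the usual trace of finite rank operators; $B$ is symmetric, invariant and non degenerate on $\mathfrak{g}$. $\bigwedge^p\mathfrak{g}$ is the space of all skew symmetric $p$-linear forms on $\mathfrak{g}$, and $H^*(\mathfrak{g})$ is the cohomology with trivial coefficients, i.e. of $\bigwedge\mathfrak{g}$ with $\partial\Omega(Y_1,\dots,Y_{p+1})=\sum_{i<j}(-1)^{i+j}\Omega([Y_i,Y_j],Y_1,\dots,\widehat{Y_i},\dots,\widehat{Y_j},\dots,Y_{p+1})$. $\mathcal{M}_a^0(\mathfrak{g})=\mathfrak{g}$, and for $k\ge1$, $\mathcal{M}_a^k(\mathfrak{g})$ is the space of skew symmetric $k$-linear maps $\mathfrak{g}^k\to\mathfrak{g}$; $d$ is the Chevalley differential of $\mathfrak{g}$ with coefficients in the adjoint representation on $\mathcal{M}_a(\mathfrak{g})=\sum_k\mathcal{M}_a^k(\mathfrak{g})$. For $C\in\mathcal{M}_a^k(\mathfrak{g})$, $\hat C(Y_1,\dots,Y_{k+1})=B(C(Y_1,\dots,Y_k),Y_{k+1})$ ($\hat C(Y)=B(C,Y)$ if $k=0$). $C$ is a cyclic cochain if $\hat C(Y_1,\dots,Y_{k+1})=(-1)^k\hat C(Y_{k+1},Y_1,\dots,Y_k)$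 for all $Y_i$, equivalently if $\hat C$ is skew symmetric. Cyclic cochains form a subcomplex $\mathcal{C}_c(\mathfrak{g})$ of $(\mathcal{M}_a(\mathfrak{g}),d)$, whose cohomology is the cyclic cohomology $H_c^*(\mathfrak{g})$. The map $\Theta(C)=\hat C$ from $\mathcal{C}_c(\mathfrak{g})$ to $\bigwedge_+\mathfrak{g}=\sum_{p\ge1}\bigwedge^p\mathfrak{g}$ is a homomorphism of complexes and induces $\Theta^*\colon H_c^k(\mathfrak{g})\to H^{k+1}(\mathfrak{g})$. *)

theory Defs
  imports Complex_Main "HOL-Library.Function_Algebras"
begin

section \<open>Quadratic Lie algebras and their cochains\<close>

text \<open>
  A complex Lie algebra is a linear subspace \<open>\<gg>\<close> of an ambient complex vector space
  together with an operation \<open>br\<close> that only matters on \<open>\<gg>\<close>.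
\<close>

locale lie_algebra = vector_space scale
  for scale :: "complex \<Rightarrow> 'a::ab_group_add \<Rightarrow> 'a" +
  fixes \<gg> :: "'a set" and br :: "'a \<Rightarrow> 'a \<Rightarrow> 'a"
  assumes subspace_carrier: "subspace \<gg>"
    and br_closed: "\<lbrakk>x \<in> \<gg>; y \<in> \<gg>\<rbrakk> \<Longrightarrow> br x y \<in> \<gg>"
    and br_add_left: "\<lbrakk>x \<in> \<gg>; y \<in> \<gg>; z \<in> \<gg>\<rbrakk> \<Longrightarrow> br (x + y) z = br x z + br y z"
    and br_add_right: "\<lbrakk>x \<in> \<gg>; y \<in> \<gg>; z \<in> \<gg>\<rbrakk> \<Longrightarrow> br x (y + z) = br x y + br x z"
    and br_scale_left: "\<lbrakk>x \<in> \<gg>; y \<in> \<gg>\<rbrakk> \<Longrightarrow> br (scale c x) y = scale c (br x y)"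
    and br_scale_right: "\<lbrakk>x \<in> \<gg>; y \<in> \<gg>\<rbrakk> \<Longrightarrow> br x (scale c y) = scale c (br x y)"
    and br_self: "x \<in> \<gg> \<Longrightarrow> br x x = 0"
    and jacobi: "\<lbrakk>x \<in> \<gg>; y \<in> \<gg>; z \<in> \<gg>\<rbrakk>
      \<Longrightarrow> br x (br y z) + br y (br z x) + br z (br x y) = 0"
begin

definition tuples :: "nat \<Rightarrow> 'a list set" where
  "tuples k = {xs. length xs = k \<and> set xs \<subseteq> \<gg>}"

text \<open>
  The \<open>k\<close>-linear skew symmetric maps from \<open>\<gg>\<close> to a subspace \<open>M\<close> of a complex vector space
  with scalar multiplication \<open>s\<close>. A map of \<open>k\<close> arguments is encoded as a function on lists,
  extended by zero outside \<open>tuples k\<close>, so that two cochains are equal iff they agree on \<open>\<gg>\<close>.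
  For \<open>k = 0\<close> a cochain is determined by its value at the empty list,
  which is an arbitrary element of \<open>M\<close>.
\<close>

definition skew_multilinear ::
  "(complex \<Rightarrow> 'b::ab_group_add \<Rightarrow> 'b) \<Rightarrow> 'b set \<Rightarrow> nat \<Rightarrow> ('a list \<Rightarrow> 'b) set" where
  "skew_multilinear s M k = {f.
     (\<forall>xs. xs \<notin> tuples k \<longrightarrow> f xs = 0) \<and>
     (\<forall>xs \<in> tuples k. f xs \<in> M) \<and>
     (\<forall>xs \<in> tuples k. \<forall>i<k. \<forall>x\<in>\<gg>. \<forall>y\<in>\<gg>. f (xs[i := x + y]) = f (xs[i := x]) + f (xs[i := y])) \<and>
     (\<forall>xs \<in> tuples k. \<forall>i<k. \<forall>x\<in>\<gg>. \<forall>c. f (xs[i := scale c x]) = s c (f (xs[i := x]))) \<and>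
     (\<forall>xs \<in> tuples k. \<forall>i<k. \<forall>j<k. i \<noteq> j \<longrightarrow> f (xs[i := xs ! j, j := xs ! i]) = - f xs)}"

definition adjoint_cochains :: "nat \<Rightarrow> ('a list \<Rightarrow> 'a) set" where
  "adjoint_cochains k = skew_multilinear scale \<gg> k"

definition skew_forms :: "nat \<Rightarrow> ('a list \<Rightarrow> complex) set" where
  "skew_forms p = skew_multilinear (*) UNIV p"

text \<open>
  The Chevalley differentials, with coefficients in the adjoint and in the trivial
  representation. Here \<open>nths xs (- I)\<close> is \<open>xs\<close> with the positions in \<open>I\<close> omitted. Positions are
  counted from \<open>0\<close>, so the sign of the first sum is \<open>(-1)\<^sup>i\<close> where counting from \<open>1\<close> gives
  \<open>(-1)\<^sup>i\<^sup>+\<^sup>1\<close>; the sign \<open>(-1)\<^sup>i\<^sup>+\<^sup>j\<close> is the same in both conventions.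
\<close>

definition adjoint_diff :: "nat \<Rightarrow> ('a list \<Rightarrow> 'a) \<Rightarrow> 'a list \<Rightarrow> 'a" where
  "adjoint_diff k C xs = (if xs \<in> tuples (Suc k) then
     (\<Sum>i<Suc k. scale ((-1) ^ i) (br (xs ! i) (C (nths xs (- {i}))))) +
     (\<Sum>j<Suc k. \<Sum>i<j. scale ((-1) ^ (i + j)) (C (br (xs ! i) (xs ! j) # nths xs (- {i, j}))))
   else 0)"

definition trivial_diff :: "nat \<Rightarrow> ('a list \<Rightarrow> complex) \<Rightarrow> 'a list \<Rightarrow> complex" where
  "trivial_diff p \<Omega> xs = (if xs \<in> tuples (Suc p) then
     (\<Sum>j<Suc p. \<Sum>i<j. (-1) ^ (i + j) * \<Omega> (br (xs ! i) (xs ! j) # nths xs (- {i, j})))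
   else 0)"

definition trivial_cocycles :: "nat \<Rightarrow> ('a list \<Rightarrow> complex) set" where
  "trivial_cocycles p = {\<Omega> \<in> skew_forms p. trivial_diff p \<Omega> = 0}"

definition trivial_coboundaries :: "nat \<Rightarrow> ('a list \<Rightarrow> complex) set" where
  "trivial_coboundaries p = (case p of 0 \<Rightarrow> {0} | Suc q \<Rightarrow> trivial_diff q ` skew_forms q)"

definition trivial_cohomologous :: "nat \<Rightarrow> (('a list \<Rightarrow> complex) \<times> ('a list \<Rightarrow> complex)) set" where
  "trivial_cohomologous p = {(\<Omega>, \<Omega>'). \<Omega> \<in> trivial_cocycles p \<and> \<Omega>' \<in> trivial_cocycles p \<and>
     \<Omega> - \<Omega>' \<in> trivial_coboundaries p}"

definition trivial_cohomology :: "nat \<Rightarrow> ('a list \<Rightarrow> complex) set set" where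
  "trivial_cohomology p = trivial_cocycles p // trivial_cohomologous p"

end

locale quadratic_lie_algebra = lie_algebra scale \<gg> br
  for scale :: "complex \<Rightarrow> 'a::ab_group_add \<Rightarrow> 'a" and \<gg> and br +
  fixes B :: "'a \<Rightarrow> 'a \<Rightarrow> complex"
  assumes form_add: "\<lbrakk>x \<in> \<gg>; y \<in> \<gg>; z \<in> \<gg>\<rbrakk> \<Longrightarrow> B (x + y) z = B x z + B y z"
    and form_scale: "\<lbrakk>x \<in> \<gg>; y \<in> \<gg>\<rbrakk> \<Longrightarrow> B (scale c x) y = c * B x y"
    and form_sym: "\<lbrakk>x \<in> \<gg>; y \<in> \<gg>\<rbrakk> \<Longrightarrow> B x y = B y x"
    and form_invariant: "\<lbrakk>x \<in> \<gg>; y \<in> \<gg>; z \<in> \<gg>\<rbrakk> \<Longrightarrow> B (br x y) z = B x (br y z)"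
    and form_nondegenerate: "\<lbrakk>x \<in> \<gg>; \<And>y. y \<in> \<gg> \<Longrightarrow> B x y = 0\<rbrakk> \<Longrightarrow> x = 0"
begin

definition Theta :: "nat \<Rightarrow> ('a list \<Rightarrow> 'a) \<Rightarrow> 'a list \<Rightarrow> complex" where
  "Theta k C xs = (if xs \<in> tuples (Suc k) then B (C (butlast xs)) (last xs) else 0)"

definition cyclic_cochains :: "nat \<Rightarrow> ('a list \<Rightarrow> 'a) set" where
  "cyclic_cochains k = {C \<in> adjoint_cochains k.
     \<forall>xs \<in> tuples (Suc k). Theta k C xs = (-1) ^ k * Theta k C (last xs # butlast xs)}"

definition cyclic_cocycles :: "nat \<Rightarrow> ('a list \<Rightarrow> 'a) set" where
  "cyclic_cocycles k = {C \<in> cyclic_cochains k. adjoint_diff k C = 0}"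

definition cyclic_coboundaries :: "nat \<Rightarrow> ('a list \<Rightarrow> 'a) set" where
  "cyclic_coboundaries k = (case k of 0 \<Rightarrow> {0} | Suc m \<Rightarrow> adjoint_diff m ` cyclic_cochains m)"

definition cyclic_cohomologous :: "nat \<Rightarrow> (('a list \<Rightarrow> 'a) \<times> ('a list \<Rightarrow> 'a)) set" where
  "cyclic_cohomologous k = {(C, C'). C \<in> cyclic_cocycles k \<and> C' \<in> cyclic_cocycles k \<and>
     C - C' \<in> cyclic_coboundaries k}"

definition cyclic_cohomology :: "nat \<Rightarrow> ('a list \<Rightarrow> 'a) set set" where
  "cyclic_cohomology k = cyclic_cocycles k // cyclic_cohomologous k"

text \<open>
  The map induced by \<open>Theta\<close> from degree \<open>k\<close> cyclic cohomology to degree \<open>k + 1\<close> cohomology: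
  the class of \<open>C\<close> goes to the class of \<open>Theta k C\<close>.
\<close>

definition Theta_star :: "nat \<Rightarrow> ('a list \<Rightarrow> 'a) set \<Rightarrow> ('a list \<Rightarrow> complex) set" where
  "Theta_star k c = trivial_cohomologous (Suc k) `` (Theta k ` c)"

end


section \<open>Finite rank operators and their trace\<close>

text \<open>
  The vector space is the whole type \<open>'v\<close> with scalar multiplication \<open>scale\<close>. Operators on it are
  functions \<open>'v \<Rightarrow> 'v\<close>, with the pointwise vector space structure.
\<close>

definition fin_dim :: "(complex \<Rightarrow> 'v::ab_group_add \<Rightarrow> 'v) \<Rightarrow> 'v set \<Rightarrow> bool" where
  "fin_dim scale U \<longleftrightarrow> (\<exists>S. finite S \<and> module.span scale S = U)"

definition op_scale :: "(complex \<Rightarrow> 'v \<Rightarrow> 'v) \<Rightarrow> complex \<Rightarrow> ('v \<Rightarrow> 'v) \<Rightarrow> 'v \<Rightarrow> 'v" where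
  "op_scale scale c T = (\<lambda>v. scale c (T v))"

definition commutator :: "('v::ab_group_add \<Rightarrow> 'v) \<Rightarrow> ('v \<Rightarrow> 'v) \<Rightarrow> 'v \<Rightarrow> 'v" where
  "commutator X Y = (X \<circ> Y) - (Y \<circ> X)"

definition finite_rank_ops :: "(complex \<Rightarrow> 'v::ab_group_add \<Rightarrow> 'v) \<Rightarrow> ('v \<Rightarrow> 'v) set" where
  "finite_rank_ops scale = {T. Vector_Spaces.linear scale scale T \<and> fin_dim scale (range T)}"

text \<open>
  The sum of the diagonal matrix entries of \<open>T\<close> in the basis \<open>S\<close>. For an operator of finite rank
  only finitely many of them are nonzero, also when \<open>S\<close> is infinite, and the sum does not
  depend on the basis (lemma \<open>trace_eq_diagonal_sum\<close> below).
\<close>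

definition diagonal_sum ::
  "(complex \<Rightarrow> 'v::ab_group_add \<Rightarrow> 'v) \<Rightarrow> 'v set \<Rightarrow> ('v \<Rightarrow> 'v) \<Rightarrow> complex" where
  "diagonal_sum scale S T =
     (\<Sum>b | b \<in> S \<and> module.representation scale S (T b) b \<noteq> 0. module.representation scale S (T b) b)"

definition trace :: "(complex \<Rightarrow> 'v::ab_group_add \<Rightarrow> 'v) \<Rightarrow> ('v \<Rightarrow> 'v) \<Rightarrow> complex" where
  "trace scale T = diagonal_sum scale (vector_space.extend_basis scale {}) T"

definition trace_form ::
  "(complex \<Rightarrow> 'v::ab_group_add \<Rightarrow> 'v) \<Rightarrow> ('v \<Rightarrow> 'v) \<Rightarrow> ('v \<Rightarrow> 'v) \<Rightarrow> complex" where
  "trace_form scale X Y = trace scale (X \<circ> Y)"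


context
  fixes scale :: "complex \<Rightarrow> 'v::ab_group_add \<Rightarrow> 'v"
  assumes vector_space: "vector_space scale"
begin

interpretation V: vector_space scale
  by (rule vector_space)

lemma fin_dim_iff:
  assumes "V.subspace U"
  shows "fin_dim scale U \<longleftrightarrow> (\<exists>F. finite F \<and> V.independent F \<and> U \<subseteq> V.span F)"
proof
  assume "fin_dim scale U"
  then obtain S where S: "finite S" "V.span S = U"
    by (auto simp: fin_dim_def)
  obtain F where "F \<subseteq> S" "V.independent F" "S \<subseteq> V.span F"
    by (rule V.maximal_independent_subset)
  then show "\<exists>F. finite F \<and> V.independent F \<and> U \<subseteq> V.span F"
    using S by (metis V.span_minimal V.subspace_span finite_subset)
next
  assume "\<exists>F. finite F \<and> V.independent F \<and> U \<subseteq> V.span F"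
  then obtain F where F: "finite F" "U \<subseteq> V.span F"
    by blast
  obtain S where S: "S \<subseteq> U" "V.independent S" "U \<subseteq> V.span S"
    by (rule V.maximal_independent_subset)
  have "finite S"
    using V.independent_span_bound[OF F(1) S(2)] F(2) S(1) by blast
  moreover have "V.span S = U"
    using S assms by (simp add: V.span_minimal subset_antisym)
  ultimately show "fin_dim scale U"
    by (auto simp: fin_dim_def)
qed

lemma finite_span_basis:
  assumes "finite S"
  obtains F where "finite F" "V.independent F" "V.span S \<subseteq> V.span F"
  using assms fin_dim_iff[of "V.span S"] by (auto simp: fin_dim_def)

lemma finite_rank_ops_iff:
  "T \<in> finite_rank_ops scale \<longleftrightarrow> Vector_Spaces.linear scale scale T \<and>
     (\<exists>F. finite F \<and> V.independent F \<and> range T \<subseteq> V.span F)"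
proof (cases "Vector_Spaces.linear scale scale T")
  case True
  then interpret T: Vector_Spaces.linear scale scale T .
  show ?thesis
    using True fin_dim_iff[of "range T"] T.subspace_image[OF V.subspace_UNIV]
    by (simp add: finite_rank_ops_def)
qed (simp add: finite_rank_ops_def)

lemma finite_rank_opsI:
  assumes "Vector_Spaces.linear scale scale T" "finite S" "range T \<subseteq> V.span S"
  shows "T \<in> finite_rank_ops scale"
  unfolding finite_rank_ops_iff
  using assms finite_span_basis[OF assms(2)] by (metis order_trans)

lemma diagonal_sum_eq_finite:
  assumes S: "V.independent S" "V.span S = UNIV"
    and T: "Vector_Spaces.linear scale scale T"
    and F: "finite F" "V.independent F" "range T \<subseteq> V.span F"
  shows "diagonal_sum scale S T = (\<Sum>e\<in>F. V.representation F (T e) e)"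
    and "finite {b \<in> S. V.representation S (T b) b \<noteq> 0}"
proof -
  interpret T: Vector_Spaces.linear scale scale T by (rule T)
  let ?r = "V.representation S" and ?q = "V.representation F"
  define K where "K = (\<Union>e\<in>F. {b. ?r e b \<noteq> 0})"
  have fK: "finite K"
    unfolding K_def using F(1) V.finite_representation by blast
  have KS: "K \<subseteq> S"
    unfolding K_def using V.representation_ne_zero by blast
  have TF: "T v \<in> V.span F" for v
    using F(3) by blast
  have expand: "?r (T b) b = (\<Sum>e\<in>F. ?q (T b) e * ?r e b)" for b
  proof -
    have "T b = (\<Sum>e\<in>F. scale (?q (T b) e) e)"
      by (rule V.sum_representation_eq[symmetric]) (use F TF in auto)
    then have "?r (T b) b = ?r (\<Sum>e\<in>F. scale (?q (T b) e) e) b"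
      by simp
    also have "\<dots> = (\<Sum>e\<in>F. ?q (T b) e * ?r e b)"
      using S by (simp add: V.representation_sum V.representation_scale)
    finally show ?thesis .
  qed
  have sub: "{b \<in> S. ?r (T b) b \<noteq> 0} \<subseteq> K"
  proof
    fix b assume "b \<in> {b \<in> S. ?r (T b) b \<noteq> 0}"
    then have "(\<Sum>e\<in>F. ?q (T b) e * ?r e b) \<noteq> 0"
      by (simp add: expand)
    then obtain e where "e \<in> F" "?q (T b) e * ?r e b \<noteq> 0"
      by (meson sum.neutral)
    then show "b \<in> K"
      by (auto simp: K_def)
  qed
  then show "finite {b \<in> S. ?r (T b) b \<noteq> 0}"
    using fK finite_subset by blast
  have "diagonal_sum scale S T = (\<Sum>b\<in>K. ?r (T b) b)"
    unfolding diagonal_sum_def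
    by (rule sum.mono_neutral_left) (use fK sub KS in auto)
  also have "\<dots> = (\<Sum>e\<in>F. \<Sum>b\<in>K. ?q (T b) e * ?r e b)"
    unfolding expand by (rule sum.swap)
  also have "\<dots> = (\<Sum>e\<in>F. ?q (T e) e)"
  proof (rule sum.cong[OF refl])
    fix e assume e: "e \<in> F"
    have "e = (\<Sum>b | ?r e b \<noteq> 0. scale (?r e b) b)"
      by (rule V.sum_nonzero_representation_eq[symmetric]) (use S in auto)
    also have "\<dots> = (\<Sum>b\<in>K. scale (?r e b) b)"
      by (rule sum.mono_neutral_left) (use fK e in \<open>auto simp: K_def\<close>)
    finally have "T e = T (\<Sum>b\<in>K. scale (?r e b) b)"
      by (rule arg_cong)
    also have "\<dots> = (\<Sum>b\<in>K. scale (?r e b) (T b))"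
      by (simp add: T.sum T.scale)
    finally have "?q (T e) e = ?q (\<Sum>b\<in>K. scale (?r e b) (T b)) e"
      by (rule arg_cong)
    also have "\<dots> = (\<Sum>b\<in>K. ?r e b * ?q (T b) e)"
      using F(2) TF by (simp add: V.representation_sum V.representation_scale V.span_scale)
    finally show "(\<Sum>b\<in>K. ?q (T b) e * ?r e b) = ?q (T e) e"
      by (simp add: mult.commute)
  qed
  finally show "diagonal_sum scale S T = (\<Sum>e\<in>F. ?q (T e) e)" .
qed

lemma trace_eq_finite:
  assumes "Vector_Spaces.linear scale scale T" "finite F" "V.independent F" "range T \<subseteq> V.span F"
  shows "trace scale T = (\<Sum>e\<in>F. V.representation F (T e) e)"
  unfolding trace_def using assms
  by (intro diagonal_sum_eq_finite(1))
    (simp_all add: V.independent_extend_basis V.span_extend_basis V.independent_empty)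

lemma trace_eq_diagonal_sum:
  assumes "T \<in> finite_rank_ops scale" "V.independent S" "V.span S = UNIV"
  shows "trace scale T = diagonal_sum scale S T"
  using assms by (auto simp: finite_rank_ops_iff trace_eq_finite diagonal_sum_eq_finite(1))

lemma finite_rank_ops_linear:
  "T \<in> finite_rank_ops scale \<Longrightarrow> Vector_Spaces.linear scale scale T"
  by (simp add: finite_rank_ops_def)

lemma common_basis:
  assumes "X \<in> finite_rank_ops scale" "Y \<in> finite_rank_ops scale"
  obtains F where "finite F" "V.independent F" "range X \<subseteq> V.span F" "range Y \<subseteq> V.span F"
proof -
  obtain G H where GH: "finite G" "range X \<subseteq> V.span G" "finite H" "range Y \<subseteq> V.span H"
    using assms by (auto simp: finite_rank_ops_iff)
  have "finite (G \<union> H)"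
    using GH by blast
  then obtain F where F: "finite F" "V.independent F" "V.span (G \<union> H) \<subseteq> V.span F"
    by (rule finite_span_basis)
  have "V.span G \<subseteq> V.span (G \<union> H)" "V.span H \<subseteq> V.span (G \<union> H)"
    by (simp_all add: V.span_mono)
  then have "range X \<subseteq> V.span F" "range Y \<subseteq> V.span F"
    using GH(2,4) F(3) by blast+
  then show thesis
    using that F(1,2) by blast
qed

lemma linear_add_op:
  assumes "Vector_Spaces.linear scale scale X" "Vector_Spaces.linear scale scale Y"
  shows "Vector_Spaces.linear scale scale (X + Y)"
  using assms by (simp add: Vector_Spaces.linear_iff V.scale_right_distrib algebra_simps)

lemma linear_diff_op:
  assumes "Vector_Spaces.linear scale scale X" "Vector_Spaces.linear scale scale Y"
  shows "Vector_Spaces.linear scale scale (X - Y)"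
  using assms by (simp add: Vector_Spaces.linear_iff V.scale_right_diff_distrib algebra_simps)

lemma linear_scale_op:
  assumes "Vector_Spaces.linear scale scale X"
  shows "Vector_Spaces.linear scale scale (op_scale scale c X)"
  using assms
  by (simp add: Vector_Spaces.linear_iff op_scale_def V.scale_right_distrib mult.commute)

lemma zero_finite_rank: "0 \<in> finite_rank_ops scale"
  by (rule finite_rank_opsI[of _ "{}"])
    (auto simp: Vector_Spaces.linear_iff vector_space V.span_zero)

lemma add_finite_rank:
  assumes "X \<in> finite_rank_ops scale" "Y \<in> finite_rank_ops scale"
  shows "X + Y \<in> finite_rank_ops scale"
proof -
  obtain F where "finite F" "range X \<subseteq> V.span F" "range Y \<subseteq> V.span F"
    by (rule common_basis[OF assms])
  then show ?thesis
    using assms[THEN finite_rank_ops_linear]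
    by (auto simp: image_subset_iff intro!: finite_rank_opsI[of _ F] linear_add_op V.span_add)
qed

lemma diff_finite_rank:
  assumes "X \<in> finite_rank_ops scale" "Y \<in> finite_rank_ops scale"
  shows "X - Y \<in> finite_rank_ops scale"
proof -
  obtain F where "finite F" "range X \<subseteq> V.span F" "range Y \<subseteq> V.span F"
    by (rule common_basis[OF assms])
  then show ?thesis
    using assms[THEN finite_rank_ops_linear]
    by (auto simp: image_subset_iff intro!: finite_rank_opsI[of _ F] linear_diff_op V.span_diff)
qed

lemma scale_finite_rank:
  assumes "X \<in> finite_rank_ops scale"
  shows "op_scale scale c X \<in> finite_rank_ops scale"
proof -
  obtain F where "finite F" "range X \<subseteq> V.span F"
    using assms by (auto simp: finite_rank_ops_iff)
  then show ?thesis
    using assms[THEN finite_rank_ops_linear] linear_scale_op[of X c]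
    by (auto simp: op_scale_def intro!: finite_rank_opsI[of _ F] V.span_scale)
qed

lemma comp_finite_rank:
  assumes "X \<in> finite_rank_ops scale" "Vector_Spaces.linear scale scale Y"
  shows "X \<circ> Y \<in> finite_rank_ops scale"
proof -
  obtain F where "finite F" "range X \<subseteq> V.span F"
    using assms by (auto simp: finite_rank_ops_iff)
  then show ?thesis
    using assms(2) finite_rank_ops_linear[OF assms(1)]
    by (auto intro!: finite_rank_opsI[of _ F] Vector_Spaces.linear_compose)
qed

lemma commutator_finite_rank:
  assumes "X \<in> finite_rank_ops scale" "Y \<in> finite_rank_ops scale"
  shows "commutator X Y \<in> finite_rank_ops scale"
  unfolding commutator_def
  by (intro diff_finite_rank comp_finite_rank assms finite_rank_ops_linear)

lemma trace_add:
  assumes "X \<in> finite_rank_ops scale" "Y \<in> finite_rank_ops scale"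
  shows "trace scale (X + Y) = trace scale X + trace scale Y"
proof -
  obtain F where F: "finite F" "V.independent F" "range X \<subseteq> V.span F" "range Y \<subseteq> V.span F"
    by (rule common_basis[OF assms])
  have "range (X + Y) \<subseteq> V.span F"
    using F by (auto intro!: V.span_add)
  moreover have "X v \<in> V.span F" "Y v \<in> V.span F" for v
    using F by auto
  ultimately show ?thesis
    using F assms
    by (simp add: trace_eq_finite[of _ F] finite_rank_ops_linear linear_add_op
        V.representation_add sum.distrib)
qed

lemma trace_scale:
  assumes "X \<in> finite_rank_ops scale"
  shows "trace scale (op_scale scale c X) = c * trace scale X"
proof -
  obtain F where F: "finite F" "V.independent F" "range X \<subseteq> V.span F"
    using assms by (auto simp: finite_rank_ops_iff)
  have "range (op_scale scale c X) \<subseteq> V.span F"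
    using F by (auto simp: op_scale_def intro!: V.span_scale)
  moreover have "X v \<in> V.span F" for v
    using F by auto
  ultimately show ?thesis
    using F assms linear_scale_op[of X c]
    by (simp add: trace_eq_finite[of _ F] finite_rank_ops_linear op_scale_def
        V.representation_scale sum_distrib_left)
qed

lemma trace_comp_commute:
  assumes X: "X \<in> finite_rank_ops scale" and Y: "Y \<in> finite_rank_ops scale"
  shows "trace scale (X \<circ> Y) = trace scale (Y \<circ> X)"
proof -
  obtain F where F: "finite F" "V.independent F" "range X \<subseteq> V.span F" "range Y \<subseteq> V.span F"
    by (rule common_basis[OF assms])
  let ?q = "V.representation F"
  have main: "trace scale (P \<circ> Q) = (\<Sum>e\<in>F. \<Sum>f\<in>F. ?q (Q e) f * ?q (P f) e)"
    if P: "Vector_Spaces.linear scale scale P" "range P \<subseteq> V.span F"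
      and Q: "Vector_Spaces.linear scale scale Q" "range Q \<subseteq> V.span F" for P Q
  proof -
    interpret P: Vector_Spaces.linear scale scale P by (rule P)
    have PF: "P v \<in> V.span F" and QF: "Q v \<in> V.span F" for v
      using P Q by auto
    have "trace scale (P \<circ> Q) = (\<Sum>e\<in>F. ?q ((P \<circ> Q) e) e)"
      by (rule trace_eq_finite) (use P Q F in \<open>auto intro: Vector_Spaces.linear_compose\<close>)
    also have "\<dots> = (\<Sum>e\<in>F. \<Sum>f\<in>F. ?q (Q e) f * ?q (P f) e)"
    proof (rule sum.cong[OF refl])
      fix e
      have "Q e = (\<Sum>f\<in>F. scale (?q (Q e) f) f)"
        by (rule V.sum_representation_eq[symmetric]) (use F QF in auto)
      then have "P (Q e) = P (\<Sum>f\<in>F. scale (?q (Q e) f) f)"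
        by (rule arg_cong)
      also have "\<dots> = (\<Sum>f\<in>F. scale (?q (Q e) f) (P f))"
        by (simp add: P.sum P.scale)
      finally have "?q (P (Q e)) e = ?q (\<Sum>f\<in>F. scale (?q (Q e) f) (P f)) e"
        by (rule arg_cong)
      also have "\<dots> = (\<Sum>f\<in>F. ?q (Q e) f * ?q (P f) e)"
        using F(2) PF by (simp add: V.representation_sum V.representation_scale V.span_scale)
      finally show "?q ((P \<circ> Q) e) e = (\<Sum>f\<in>F. ?q (Q e) f * ?q (P f) e)"
        by simp
    qed
    finally show ?thesis .
  qed
  have "trace scale (X \<circ> Y) = (\<Sum>e\<in>F. \<Sum>f\<in>F. ?q (Y e) f * ?q (X f) e)"
    using X Y F by (simp add: main finite_rank_ops_linear)
  also have "\<dots> = (\<Sum>f\<in>F. \<Sum>e\<in>F. ?q (Y e) f * ?q (X f) e)"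
    by (rule sum.swap)
  also have "\<dots> = trace scale (Y \<circ> X)"
    using X Y F by (simp add: main finite_rank_ops_linear mult.commute)
  finally show ?thesis .
qed

lemma trace_diff:
  assumes "X \<in> finite_rank_ops scale" "Y \<in> finite_rank_ops scale"
  shows "trace scale (X - Y) = trace scale X - trace scale Y"
  using trace_add[OF diff_finite_rank[OF assms] assms(2)] by simp

lemma trace_form_nondegenerate:
  assumes X: "X \<in> finite_rank_ops scale"
    and zero: "\<And>Y. Y \<in> finite_rank_ops scale \<Longrightarrow> trace_form scale X Y = 0"
  shows "X = 0"
proof (rule ccontr)
  assume "X \<noteq> 0"
  then obtain v where v: "X v \<noteq> 0"
    by (auto simp: fun_eq_iff)
  interpret X: Vector_Spaces.linear scale scale X
    by (rule finite_rank_ops_linear[OF X])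
  let ?w = "X v"
  let ?S = "V.extend_basis {?w}"
  have iw: "V.independent {?w}"
    using v by simp
  have S: "V.independent ?S" "V.span ?S = UNIV" "?w \<in> ?S"
    using V.independent_extend_basis[OF iw] V.span_extend_basis[OF iw]
      V.extend_basis_superset[OF iw] by auto
  define \<phi> where "\<phi> u = V.representation ?S u ?w" for u
  have \<phi>: "\<phi> (x + y) = \<phi> x + \<phi> y" "\<phi> (scale c x) = c * \<phi> x" "\<phi> ?w = 1" for x y c
    using S by (simp_all add: \<phi>_def V.representation_add V.representation_scale V.representation_basis)
  define Y where "Y u = scale (\<phi> u) v" for u
  have linY: "Vector_Spaces.linear scale scale Y"
    by (simp add: Vector_Spaces.linear_iff vector_space Y_def \<phi> V.scale_left_distrib)
  have Y: "Y \<in> finite_rank_ops scale"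
    by (rule finite_rank_opsI[OF linY, of "{v}"]) (auto simp: Y_def V.span_base V.span_scale)
  have "trace scale (X \<circ> Y) = (\<Sum>e\<in>{?w}. V.representation {?w} ((X \<circ> Y) e) e)"
  proof (rule trace_eq_finite)
    show "range (X \<circ> Y) \<subseteq> V.span {?w}"
      by (auto simp: Y_def X.scale V.span_base V.span_scale)
  qed (use iw X.linear_axioms linY in \<open>auto intro: Vector_Spaces.linear_compose\<close>)
  also have "\<dots> = 1"
    using iw by (simp add: Y_def X.scale \<phi> V.representation_basis)
  finally show False
    using zero[OF Y] by (simp add: trace_form_def)
qed

theorem finite_rank_quadratic_lie_algebra:
  "quadratic_lie_algebra (op_scale scale) (finite_rank_ops scale) commutator (trace_form scale)"
proof -
  interpret O: vector_space "op_scale scale"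
    by unfold_locales
      (simp_all add: op_scale_def fun_eq_iff V.scale_right_distrib V.scale_left_distrib)
  note lin = finite_rank_ops_linear[THEN Vector_Spaces.linear_iff[THEN iffD1]]
  have lin_diff: "X (a - b) = X a - X b" if "X \<in> finite_rank_ops scale" for X a b
    using that finite_rank_ops_linear module_hom.diff Vector_Spaces.linear.axioms(3) by blast
  show ?thesis
  proof
    fix x y z :: "'v \<Rightarrow> 'v" and c :: complex
    assume x: "x \<in> finite_rank_ops scale"
    show "commutator x x = 0"
      by (simp add: commutator_def)
    show "x = 0" if "\<And>y. y \<in> finite_rank_ops scale \<Longrightarrow> trace_form scale x y = 0"
      using trace_form_nondegenerate[OF x that] .
    assume y: "y \<in> finite_rank_ops scale"
    show "commutator x y \<in> finite_rank_ops scale"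
      by (rule commutator_finite_rank[OF x y])
    show "commutator (op_scale scale c x) y = op_scale scale c (commutator x y)"
      and "commutator x (op_scale scale c y) = op_scale scale c (commutator x y)"
      using lin[OF x] lin[OF y]
      by (simp_all add: commutator_def op_scale_def fun_eq_iff V.scale_right_diff_distrib)
    show "trace_form scale (op_scale scale c x) y = c * trace_form scale x y"
    proof -
      have "op_scale scale c x \<circ> y = op_scale scale c (x \<circ> y)"
        by (simp add: op_scale_def fun_eq_iff)
      then show ?thesis
        by (simp add: trace_form_def trace_scale comp_finite_rank x y finite_rank_ops_linear)
    qed
    show "trace_form scale x y = trace_form scale y x"
      unfolding trace_form_def by (rule trace_comp_commute[OF x y])
    assume z: "z \<in> finite_rank_ops scale"
    show "commutator (x + y) z = commutator x z + commutator y z"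
      and "commutator x (y + z) = commutator x y + commutator x z"
      using lin[OF x] lin[OF z] by (simp_all add: commutator_def fun_eq_iff)
    show "commutator x (commutator y z) + commutator y (commutator z x)
        + commutator z (commutator x y) = 0"
      by (simp add: commutator_def fun_eq_iff lin_diff x y z)
    show "trace_form scale (x + y) z = trace_form scale x z + trace_form scale y z"
    proof -
      have "(x + y) \<circ> z = (x \<circ> z) + (y \<circ> z)"
        by (simp add: fun_eq_iff)
      then show ?thesis
        by (simp add: trace_form_def trace_add comp_finite_rank x y z finite_rank_ops_linear)
    qed
    show "trace_form scale (commutator x y) z = trace_form scale x (commutator y z)"
    proof -
      note fr = comp_finite_rank finite_rank_ops_linear x y z
      have 1: "commutator x y \<circ> z = (x \<circ> (y \<circ> z)) - (y \<circ> (x \<circ> z))"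
        by (simp add: commutator_def fun_eq_iff)
      have 2: "x \<circ> commutator y z = (x \<circ> (y \<circ> z)) - ((x \<circ> z) \<circ> y)"
        by (simp add: commutator_def fun_eq_iff lin_diff x)
      have "trace scale (y \<circ> (x \<circ> z)) = trace scale ((x \<circ> z) \<circ> y)"
        by (rule trace_comp_commute) (simp_all add: fr)
      then show ?thesis
        unfolding trace_form_def 1 2 by (simp add: trace_diff fr)
    qed
  next
    show "O.subspace (finite_rank_ops scale)"
      by (auto simp: O.subspace_def zero_finite_rank add_finite_rank scale_finite_rank)
  qed
qed

end

end

theory Submission
  imports Defs
begin

text \<open>
  Let \<open>f\<close> be a linear form on \<open>\<gg>\<close> and let \<open>D\<close> satisfy \<open>B (D x) y = f [x, y]\<close>. By nondegeneracy of
  \<open>B\<close>, \<open>D\<close> is a skew symmetric derivation, i.e. a cyclic \<open>1\<close>-cocycle, and its image under \<open>\<Theta>\<close> is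
  the coboundary of \<open>-f\<close>. The cyclic \<open>1\<close>-coboundaries are the inner derivations, so \<open>\<Theta>\<^sup>*\<close> is not
  injective as soon as such a \<open>D\<close> is not inner. For finite rank operators take
  \<open>f Z = Tr (A Z)\<close> and \<open>D X = [A, X]\<close> with \<open>A\<close> a projection of infinite rank and corank: if \<open>D\<close> were
  inner, then \<open>A\<close> would differ from an operator of finite rank by an operator that commutes with all
  operators of finite rank, that is, by a scalar.
\<close>

section \<open>Cochains of low degree and coboundaries with trivial coefficients\<close>

context lie_algebra
begin

lemma tuples_0_iff: "xs \<in> tuples 0 \<longleftrightarrow> xs = []"
  by (auto simp: tuples_def)

lemma tuples_Suc_iff: "xs \<in> tuples (Suc k) \<longleftrightarrow> (\<exists>x\<in>\<gg>. \<exists>ys\<in>tuples k. xs = x # ys)"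
  by (cases xs) (auto simp: tuples_def)

lemmas tuples_iff = tuples_0_iff tuples_Suc_iff

lemma ball_tuples_iff:
  "(\<forall>xs\<in>tuples 0. P xs) \<longleftrightarrow> P []"
  "(\<forall>xs\<in>tuples (Suc k). P xs) \<longleftrightarrow> (\<forall>x\<in>\<gg>. \<forall>ys\<in>tuples k. P (x # ys))"
  by (auto simp: tuples_iff)

lemma carrier_closed:
  "0 \<in> \<gg>" "x \<in> \<gg> \<Longrightarrow> y \<in> \<gg> \<Longrightarrow> x + y \<in> \<gg>" "x \<in> \<gg> \<Longrightarrow> y \<in> \<gg> \<Longrightarrow> x - y \<in> \<gg>"
  "x \<in> \<gg> \<Longrightarrow> - x \<in> \<gg>" "x \<in> \<gg> \<Longrightarrow> scale c x \<in> \<gg>"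
  using subspace_carrier
  by (auto intro: subspace_0 subspace_add subspace_diff subspace_neg subspace_scale)

lemma br_anti:
  assumes "x \<in> \<gg>" "y \<in> \<gg>"
  shows "br y x = - br x y"
proof -
  have "br (x + y) (x + y) = 0"
    using assms by (intro br_self carrier_closed)
  then show ?thesis
    using assms
    by (simp add: br_add_left br_add_right carrier_closed br_self[OF assms(1)] br_self[OF assms(2)]
        eq_neg_iff_add_eq_0 add.commute)
qed

lemma br_neg_right: "x \<in> \<gg> \<Longrightarrow> y \<in> \<gg> \<Longrightarrow> br x (- y) = - br x y"
  using br_scale_right[of x y "-1"] by simp

lemma skew_multilinear_1_iff:
  "f \<in> skew_multilinear s M (Suc 0) \<longleftrightarrow>
     (\<forall>xs. xs \<notin> tuples (Suc 0) \<longrightarrow> f xs = 0) \<and> (\<forall>x\<in>\<gg>. f [x] \<in> M) \<and>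
     (\<forall>x\<in>\<gg>. \<forall>y\<in>\<gg>. f [x + y] = f [x] + f [y]) \<and> (\<forall>x\<in>\<gg>. \<forall>c. f [scale c x] = s c (f [x]))"
  unfolding skew_multilinear_def by (auto simp: ball_tuples_iff)

lemma skew_multilinear_2I:
  assumes "\<And>xs. xs \<notin> tuples (Suc (Suc 0)) \<Longrightarrow> f xs = 0"
    and M: "\<And>x y. x \<in> \<gg> \<Longrightarrow> y \<in> \<gg> \<Longrightarrow> f [x, y] \<in> M"
    and add: "\<And>x x' y. x \<in> \<gg> \<Longrightarrow> x' \<in> \<gg> \<Longrightarrow> y \<in> \<gg> \<Longrightarrow> f [x + x', y] = f [x, y] + f [x', y]"
      "\<And>x y y'. x \<in> \<gg> \<Longrightarrow> y \<in> \<gg> \<Longrightarrow> y' \<in> \<gg> \<Longrightarrow> f [x, y + y'] = f [x, y] + f [x, y']"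
    and sc: "\<And>c x y. x \<in> \<gg> \<Longrightarrow> y \<in> \<gg> \<Longrightarrow> f [scale c x, y] = s c (f [x, y])"
      "\<And>c x y. x \<in> \<gg> \<Longrightarrow> y \<in> \<gg> \<Longrightarrow> f [x, scale c y] = s c (f [x, y])"
    and skew: "\<And>x y. x \<in> \<gg> \<Longrightarrow> y \<in> \<gg> \<Longrightarrow> f [y, x] = - f [x, y]"
  shows "f \<in> skew_multilinear s M (Suc (Suc 0))"
  unfolding skew_multilinear_def
  using assms(1-6) by (auto simp: ball_tuples_iff less_Suc_eq intro: skew)

lemma trivial_diff_1:
  assumes "x \<in> \<gg>" "y \<in> \<gg>"
  shows "trivial_diff (Suc 0) f [x, y] = - f [br x y]"
  using assms by (simp add: trivial_diff_def tuples_iff nths_Cons)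

lemma trivial_diff_2:
  assumes "x \<in> \<gg>" "y \<in> \<gg>" "z \<in> \<gg>"
  shows "trivial_diff (Suc (Suc 0)) f [x, y, z] = - f [br x y, z] + f [br x z, y] - f [br y z, x]"
  using assms by (simp add: trivial_diff_def tuples_iff nths_Cons)

lemma skew_form_1D:
  assumes "f \<in> skew_forms (Suc 0)"
  shows "x \<in> \<gg> \<Longrightarrow> y \<in> \<gg> \<Longrightarrow> f [x + y] = f [x] + f [y]"
    and "x \<in> \<gg> \<Longrightarrow> f [scale c x] = c * f [x]"
    and "x \<in> \<gg> \<Longrightarrow> f [- x] = - f [x]"
    and "f [0] = 0"
proof -
  show sc: "f [scale c x] = c * f [x]" if "x \<in> \<gg>" for c x
    using assms that by (simp add: skew_forms_def skew_multilinear_1_iff)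
  show "x \<in> \<gg> \<Longrightarrow> y \<in> \<gg> \<Longrightarrow> f [x + y] = f [x] + f [y]"
    using assms by (simp add: skew_forms_def skew_multilinear_1_iff)
  show "x \<in> \<gg> \<Longrightarrow> f [- x] = - f [x]" "f [0] = 0"
    using sc[of x "-1"] sc[of 0 0] by (simp_all add: carrier_closed)
qed

text \<open>This is the Jacobi identity seen through a linear form, the lowest case of the
  differential squaring to zero. It makes every \<open>2\<close>-coboundary a cocycle, so the
  coboundaries form exactly the zero class.\<close>

lemma trivial_diff_1_cocycle:
  assumes f: "f \<in> skew_forms (Suc 0)"
  shows "trivial_diff (Suc 0) f \<in> trivial_cocycles (Suc (Suc 0))"
proof -
  note lin = skew_form_1D[OF f]
  have "trivial_diff (Suc 0) f \<in> skew_forms (Suc (Suc 0))"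
    unfolding skew_forms_def
  proof (rule skew_multilinear_2I)
    show "trivial_diff (Suc 0) f xs = 0" if "xs \<notin> tuples (Suc (Suc 0))" for xs
      using that by (simp add: trivial_diff_def)
    show "trivial_diff (Suc 0) f [y, x] = - trivial_diff (Suc 0) f [x, y]"
      if "x \<in> \<gg>" "y \<in> \<gg>" for x y
      using that by (simp add: trivial_diff_1 br_anti[of x y] lin br_closed)
  qed (simp_all add: trivial_diff_1 lin br_closed carrier_closed br_add_left br_add_right
      br_scale_left br_scale_right)
  moreover have "trivial_diff (Suc (Suc 0)) (trivial_diff (Suc 0) f) = 0"
  proof
    fix xs
    show "trivial_diff (Suc (Suc 0)) (trivial_diff (Suc 0) f) xs = 0 xs"
    proof (cases "xs \<in> tuples (Suc (Suc (Suc 0)))")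
      case True
      then obtain x y z where xs: "xs = [x, y, z]" and g: "x \<in> \<gg>" "y \<in> \<gg>" "z \<in> \<gg>"
        by (auto simp: tuples_iff)
      have "f [br x (br y z)] + f [br y (br z x)] + f [br z (br x y)] = 0"
        using jacobi[OF g] g by (simp add: lin(1,4) br_closed carrier_closed flip: lin(1))
      then have "f [br x (br y z)] + f [br z (br x y)] = - f [br y (br z x)]"
        by (simp add: eq_neg_iff_add_eq_0 add_ac)
      \<comment> \<open>The double brackets in \<open>trivial_diff_2\<close> are nested on the left,
        those of \<open>jacobi\<close> on the right and in cyclic order. For
        \<open>br (br x z) y\<close> two reversals are needed, so its sign does not change.\<close>
      moreover have "f [br (br x y) z] = - f [br z (br x y)]"
        "f [br (br y z) x] = - f [br x (br y z)]" "f [br (br x z) y] = f [br y (br z x)]"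
        using g br_anti[of z "br x y"] br_anti[of x "br y z"] br_anti[of y "br x z"]
          br_anti[of x z]
        by (simp_all add: lin br_closed br_neg_right)
      ultimately show ?thesis
        using g by (simp add: xs trivial_diff_2 trivial_diff_1 br_closed algebra_simps)
    qed (simp add: trivial_diff_def)
  qed
  ultimately show ?thesis
    by (simp add: trivial_cocycles_def)
qed

lemma trivial_coboundaries_2_diff:
  assumes "\<Omega> \<in> trivial_coboundaries (Suc (Suc 0))" "\<Omega>' \<in> trivial_coboundaries (Suc (Suc 0))"
  shows "\<Omega> - \<Omega>' \<in> trivial_coboundaries (Suc (Suc 0))"
proof -
  obtain f f' where f: "f \<in> skew_forms (Suc 0)" "f' \<in> skew_forms (Suc 0)"
    and \<Omega>: "\<Omega> = trivial_diff (Suc 0) f" "\<Omega>' = trivial_diff (Suc 0) f'"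
    using assms by (auto simp: trivial_coboundaries_def)
  have "f - f' \<in> skew_forms (Suc 0)"
    using f by (simp add: skew_forms_def skew_multilinear_1_iff algebra_simps)
  moreover have "\<Omega> - \<Omega>' = trivial_diff (Suc 0) (f - f')"
    by (auto simp: \<Omega> trivial_diff_def fun_eq_iff tuples_iff)
  ultimately show ?thesis
    by (simp add: trivial_coboundaries_def)
qed

lemma trivial_coboundaries_2_subset:
  "trivial_coboundaries (Suc (Suc 0)) \<subseteq> trivial_cocycles (Suc (Suc 0))"
  by (auto simp: trivial_coboundaries_def trivial_diff_1_cocycle)

end

section \<open>Derivations given by a linear form \<open>f\<close>, called its potential, and the
  classes they define\<close>

context quadratic_lie_algebra
begin

lemma form_diff:
  assumes "x \<in> \<gg>" "y \<in> \<gg>" "z \<in> \<gg>"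
  shows "B (x - y) z = B x z - B y z"
  using form_add[of "x - y" y z] assms by (simp add: carrier_closed)

lemma form_neg: "x \<in> \<gg> \<Longrightarrow> y \<in> \<gg> \<Longrightarrow> B (- x) y = - B x y"
  using form_scale[of x y "-1"] by simp

text \<open>Nondegeneracy as an extensionality principle: identities between values of
  \<open>C\<close> can be tested against every \<open>z\<close>, where they turn into identities for
  the potential.\<close>

lemma form_eqI:
  assumes "x \<in> \<gg>" "y \<in> \<gg>" "\<And>z. z \<in> \<gg> \<Longrightarrow> B x z = B y z"
  shows "x = y"
  using form_nondegenerate[of "x - y"] assms by (simp add: carrier_closed form_diff)

lemma Theta_1:
  assumes "x \<in> \<gg>" "y \<in> \<gg>"
  shows "Theta (Suc 0) C [x, y] = B (C [x]) y"
  using assms by (simp add: Theta_def tuples_iff)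

lemma adjoint_diff_0:
  assumes "x \<in> \<gg>"
  shows "adjoint_diff 0 C [x] = br x (C [])"
  using assms by (simp add: adjoint_diff_def tuples_iff nths_Cons)

lemma adjoint_diff_1:
  assumes "x \<in> \<gg>" "y \<in> \<gg>"
  shows "adjoint_diff (Suc 0) C [x, y] = br x (C [y]) - br y (C [x]) - C [br x y]"
  using assms by (simp add: adjoint_diff_def tuples_iff nths_Cons)

text \<open>A \<open>0\<close>-cochain is a vector, its value at the empty list, so its differential
  is bracketing with that vector. Coboundaries in degree one are therefore inner
  derivations.\<close>

lemma cyclic_coboundary_1D:
  assumes "C \<in> cyclic_coboundaries (Suc 0)"
  shows "\<exists>F\<in>\<gg>. \<forall>x\<in>\<gg>. C [x] = br x F"
proof -
  obtain G where G: "G \<in> cyclic_cochains 0" "C = adjoint_diff 0 G"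
    using assms by (auto simp: cyclic_coboundaries_def)
  then have "G [] \<in> \<gg>"
    by (simp add: cyclic_cochains_def adjoint_cochains_def skew_multilinear_def tuples_iff)
  then show ?thesis
    using G(2) by (auto simp: adjoint_diff_0)
qed

lemma zero_cyclic_coboundary_1: "0 \<in> cyclic_coboundaries (Suc 0)"
proof -
  have "0 \<in> cyclic_cochains 0"
    using form_scale[of 0 _ 0]
    by (auto simp: cyclic_cochains_def adjoint_cochains_def skew_multilinear_def tuples_iff
        Theta_def carrier_closed)
  moreover have "adjoint_diff 0 0 = 0"
    using br_scale_right[of _ 0 0]
    by (auto simp: adjoint_diff_def fun_eq_iff tuples_iff carrier_closed)
  ultimately show ?thesis
    by (force simp: cyclic_coboundaries_def)
qed

text \<open>Everything is inherited from the bracket by pairing with \<open>B\<close>: linearity of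
  \<open>C\<close> from bilinearity, cyclicity from antisymmetry, and the derivation rule from the
  Jacobi identity.\<close>

lemma potential_cyclic_cocycle:
  assumes supp: "\<And>xs. xs \<notin> tuples (Suc 0) \<Longrightarrow> C xs = 0"
    and C: "\<And>x. x \<in> \<gg> \<Longrightarrow> C [x] \<in> \<gg>"
    and f: "f \<in> skew_forms (Suc 0)"
    and Cf: "\<And>x y. x \<in> \<gg> \<Longrightarrow> y \<in> \<gg> \<Longrightarrow> B (C [x]) y = f [br x y]"
  shows "C \<in> cyclic_cocycles (Suc 0)"
proof -
  note lin = skew_form_1D[OF f]
  have "C [x + y] = C [x] + C [y]" if "x \<in> \<gg>" "y \<in> \<gg>" for x y
    by (rule form_eqI)
      (use that in \<open>simp_all add: C Cf carrier_closed form_add br_add_left br_closed lin\<close>)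
  moreover have "C [scale c x] = scale c (C [x])" if "x \<in> \<gg>" for x c
    by (rule form_eqI)
      (use that in \<open>simp_all add: C Cf carrier_closed form_scale br_scale_left br_closed lin\<close>)
  ultimately have "C \<in> adjoint_cochains (Suc 0)"
    using supp C by (simp add: adjoint_cochains_def skew_multilinear_1_iff)
  moreover have "Theta (Suc 0) C xs = - Theta (Suc 0) C (last xs # butlast xs)"
    if xs: "xs \<in> tuples (Suc (Suc 0))" for xs
  proof -
    obtain x y where "xs = [x, y]" "x \<in> \<gg>" "y \<in> \<gg>"
      using xs by (auto simp: tuples_iff)
    then show ?thesis
      by (simp add: Theta_1 Cf br_anti[of x y] br_closed lin)
  qed
  moreover have "adjoint_diff (Suc 0) C [x, y] = 0" if g: "x \<in> \<gg>" "y \<in> \<gg>" for x y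
  proof -
    have "br x (C [y]) - br y (C [x]) = C [br x y]"
    proof (rule form_eqI)
      fix z assume z: "z \<in> \<gg>"
      \<comment> \<open>Reversing the bracket gives the sign; invariance then moves \<open>u\<close>
        onto \<open>z\<close>, leaving \<open>B (C [v]) (br u z)\<close>, which the potential
        evaluates.\<close>
      have eq: "B (br u (C [v])) z = - f [br v (br u z)]" if "u \<in> \<gg>" "v \<in> \<gg>" for u v
        using that z form_invariant[of "C [v]" u z] br_anti[of "C [v]" u]
        by (simp add: C Cf form_neg br_closed)
      \<comment> \<open>Jacobi in the form: the adjoint action is a representation. Applying
        \<open>f\<close> to it gives the derivation rule paired with \<open>z\<close>.\<close>
      have "br x (br y z) - br y (br x z) = br (br x y) z"
        using jacobi[OF g z] g z br_anti[of x z] br_anti[of "br x y" z]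
        by (simp add: br_closed br_neg_right algebra_simps)
      then have "f [br x (br y z)] = f [br (br x y) z] + f [br y (br x z)]"
        using g z by (simp add: br_closed algebra_simps flip: lin(1))
      then show "B (br x (C [y]) - br y (C [x])) z = B (C [br x y]) z"
        using g z by (simp add: form_diff C br_closed eq Cf)
    qed (use g in \<open>simp_all add: C br_closed carrier_closed\<close>)
    then show ?thesis
      using g by (simp add: adjoint_diff_1)
  qed
  then have "adjoint_diff (Suc 0) C xs = 0" for xs
    by (cases "xs \<in> tuples (Suc (Suc 0))") (fastforce simp: tuples_iff, simp add: adjoint_diff_def)
  then have "adjoint_diff (Suc 0) C = 0"
    by (simp add: fun_eq_iff)
  ultimately show ?thesis
    by (simp add: cyclic_cocycles_def cyclic_cochains_def)
qed

lemma potential_Theta_coboundary: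
  assumes f: "f \<in> skew_forms (Suc 0)"
    and Cf: "\<And>x y. x \<in> \<gg> \<Longrightarrow> y \<in> \<gg> \<Longrightarrow> B (C [x]) y = f [br x y]"
  shows "Theta (Suc 0) C \<in> trivial_coboundaries (Suc (Suc 0))"
proof -
  \<comment> \<open>The sign compensates the factor \<open>-1\<close> that
    \<open>trivial_diff\<close> gives to the pair of positions 0 and 1.\<close>
  have "- f \<in> skew_forms (Suc 0)"
    using f by (auto simp: skew_forms_def skew_multilinear_1_iff)
  moreover have "Theta (Suc 0) C xs = trivial_diff (Suc 0) (- f) xs" for xs
  proof (cases "xs \<in> tuples (Suc (Suc 0))")
    case True
    then show ?thesis
      by (auto simp: tuples_iff Theta_1 trivial_diff_1 Cf)
  qed (simp add: Theta_def trivial_diff_def)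
  ultimately show ?thesis
    unfolding trivial_coboundaries_def by auto
qed

text \<open>\<open>Theta_star\<close> takes the image of a whole class, so every representative has
  to be controlled. Each one differs from \<open>C\<close> by an inner derivation, which has a
  potential of its own, so all the images are coboundaries and together they generate the zero
  class.\<close>

lemma Theta_star_potential_class:
  assumes C: "C \<in> cyclic_cocycles (Suc 0)"
    and f: "f \<in> skew_forms (Suc 0)"
    and Cf: "\<And>x y. x \<in> \<gg> \<Longrightarrow> y \<in> \<gg> \<Longrightarrow> B (C [x]) y = f [br x y]"
  shows "Theta_star (Suc 0) (cyclic_cohomologous (Suc 0) `` {C}) = trivial_coboundaries (Suc (Suc 0))"
proof -
  let ?c = "cyclic_cohomologous (Suc 0) `` {C}"
  have Theta: "Theta (Suc 0) C' \<in> trivial_coboundaries (Suc (Suc 0))" if C': "C' \<in> ?c" for C'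
  proof -
    have "C - C' \<in> cyclic_coboundaries (Suc 0)"
      using C' by (simp add: cyclic_cohomologous_def)
    then obtain F where F: "F \<in> \<gg>" and "\<And>x. x \<in> \<gg> \<Longrightarrow> (C - C') [x] = br x F"
      using cyclic_coboundary_1D by blast
    then have C'_eq: "C' [x] = C [x] - br x F" if "x \<in> \<gg>" for x
      using that by (simp add: algebra_simps)
    have Cg: "C [x] \<in> \<gg>" if "x \<in> \<gg>" for x
      using C that by (simp add: cyclic_cocycles_def cyclic_cochains_def adjoint_cochains_def
          skew_multilinear_1_iff)
    \<comment> \<open>By invariance, \<open>- B (br x F) y = B (br F x) y = B F (br x y)\<close>.
      Hence subtracting \<open>br x F\<close> from \<open>C [x]\<close> adds the linear form
      \<open>B F\<close> to the potential.\<close>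
    define f' where "f' xs = (if xs \<in> tuples (Suc 0) then f xs + B F (hd xs) else 0)" for xs
    have "f' \<in> skew_forms (Suc 0)"
      using f F by (simp add: f'_def skew_forms_def skew_multilinear_1_iff tuples_iff
          carrier_closed form_sym[of F] form_add form_scale algebra_simps)
    moreover have "B (C' [x]) y = f' [br x y]" if "x \<in> \<gg>" "y \<in> \<gg>" for x y
      using that F Cg form_invariant[of F x y]
      by (simp add: C'_eq form_diff br_closed Cf f'_def tuples_iff br_anti[of F x] form_add)
    ultimately show ?thesis
      by (rule potential_Theta_coboundary)
  qed
  have "C \<in> ?c"
    using C zero_cyclic_coboundary_1 by (simp add: cyclic_cohomologous_def)
  \<comment> \<open>The class of a coboundary is the set of all coboundaries: write \<Omega>' as
    \<open>\<Omega> - (\<Omega> - \<Omega>')\<close>; the cocycle conditions follow from the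
    inclusion of coboundaries in cocycles.\<close>
  moreover have "(\<Omega>, \<Omega>') \<in> trivial_cohomologous (Suc (Suc 0)) \<longleftrightarrow>
      \<Omega>' \<in> trivial_coboundaries (Suc (Suc 0))"
    if "\<Omega> \<in> trivial_coboundaries (Suc (Suc 0))" for \<Omega> \<Omega>'
    using that trivial_coboundaries_2_diff[of \<Omega> "\<Omega> - \<Omega>'"] trivial_coboundaries_2_diff[of \<Omega> \<Omega>']
      trivial_coboundaries_2_subset
    by (auto simp: trivial_cohomologous_def)
  ultimately show ?thesis
    using Theta unfolding Theta_star_def by blast
qed

text \<open>The classes of \<open>D\<close> and of the zero cocycle both have potentials, so they
  have the same image. Injectivity would identify them and make \<open>D\<close> inner.\<close>

proposition Theta_star_1_not_inj:
  assumes D: "\<And>x. x \<in> \<gg> \<Longrightarrow> D x \<in> \<gg>"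
    and f_add: "\<And>x y. x \<in> \<gg> \<Longrightarrow> y \<in> \<gg> \<Longrightarrow> f (x + y) = f x + f y"
    and f_scale: "\<And>c x. x \<in> \<gg> \<Longrightarrow> f (scale c x) = c * f x"
    and Df: "\<And>x y. x \<in> \<gg> \<Longrightarrow> y \<in> \<gg> \<Longrightarrow> B (D x) y = f (br x y)"
    and outer: "\<not> (\<exists>F\<in>\<gg>. \<forall>x\<in>\<gg>. D x = br F x)"
  shows "\<not> inj_on (Theta_star 1) (cyclic_cohomology 1)"
proof
  assume inj: "inj_on (Theta_star 1) (cyclic_cohomology 1)"
  \<comment> \<open>\<open>C\<close> and \<open>h\<close> are \<open>D\<close> and \<open>f\<close>
    in the list encoding of cochains, with the required value zero off the carrier.\<close>
  define C where "C xs = (if xs \<in> tuples (Suc 0) then D (hd xs) else 0)" for xs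
  define h where "h xs = (if xs \<in> tuples (Suc 0) then f (hd xs) else 0)" for xs
  have h: "h \<in> skew_forms (Suc 0)"
    by (simp add: h_def skew_forms_def skew_multilinear_1_iff tuples_iff f_add f_scale
        carrier_closed)
  have Ch: "B (C [x]) y = h [br x y]" if "x \<in> \<gg>" "y \<in> \<gg>" for x y
    using that by (simp add: C_def h_def tuples_iff Df br_closed)
  have C: "C \<in> cyclic_cocycles (Suc 0)"
    using h Ch by (rule potential_cyclic_cocycle[rotated 2]) (auto simp: C_def tuples_iff D)
  have 0: "0 \<in> skew_forms (Suc 0)"
    by (simp add: skew_forms_def skew_multilinear_1_iff)
  have B0: "B ((0::'a list \<Rightarrow> 'a) [x]) y = (0::'a list \<Rightarrow> complex) [br x y]" if "x \<in> \<gg>" "y \<in> \<gg>" for x y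
    using form_scale[of 0 y 0] that by (simp add: carrier_closed)
  have Z: "0 \<in> cyclic_cocycles (Suc 0)"
    using 0 B0 by (rule potential_cyclic_cocycle[rotated 2]) (auto simp: carrier_closed)
  let ?R = "cyclic_cohomologous (Suc 0)"
  have "?R `` {C} \<in> cyclic_cohomology 1" "?R `` {0} \<in> cyclic_cohomology 1"
    using C Z by (simp_all add: cyclic_cohomology_def quotientI)
  moreover have "Theta_star 1 (?R `` {C}) = Theta_star 1 (?R `` {0})"
    using Theta_star_potential_class[OF C h Ch] Theta_star_potential_class[of 0 0, OF Z 0 B0] by simp
  ultimately have "?R `` {C} = ?R `` {0}"
    using inj by (simp add: inj_on_def)
  \<comment> \<open>Zero lies in its own class, hence in that of \<open>C\<close>; this alone shows
    that \<open>C\<close> is a coboundary.\<close>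
  moreover have "0 \<in> ?R `` {0}"
    using Z zero_cyclic_coboundary_1 by (simp add: cyclic_cohomologous_def)
  ultimately have "(C, 0) \<in> ?R"
    by blast
  then have "C \<in> cyclic_coboundaries (Suc 0)"
    by (simp add: cyclic_cohomologous_def)
  then obtain F where F: "F \<in> \<gg>" "\<And>x. x \<in> \<gg> \<Longrightarrow> C [x] = br x F"
    using cyclic_coboundary_1D by blast
  \<comment> \<open>The differential puts the vector on the right of the bracket; moving it to the
    left changes its sign.\<close>
  then have "D x = br (- F) x" if "x \<in> \<gg>" for x
    using that br_scale_left[of F x "-1"] br_anti[of F x] F(2)[of x] by (simp add: C_def tuples_iff)
  then show False
    using outer F(1) carrier_closed(4) by blast
qed

end

section \<open>Finite rank operators inside all linear operators: ideal, trace, commutant, and a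
  suitable \<open>A\<close>\<close>

context
  fixes scale :: "complex \<Rightarrow> 'v::ab_group_add \<Rightarrow> 'v"
  assumes vector_space: "vector_space scale"
begin

interpretation V: vector_space scale
  by (rule vector_space)

text \<open>Together with \<open>comp_finite_rank\<close> this makes the finite rank operators a
  two-sided ideal, so bracketing with an arbitrary linear operator preserves them.\<close>

lemma comp_finite_rank_left:
  assumes X: "Vector_Spaces.linear scale scale X" and Y: "Y \<in> finite_rank_ops scale"
  shows "X \<circ> Y \<in> finite_rank_ops scale"
proof -
  interpret X: Vector_Spaces.linear scale scale X by (rule X)
  obtain F where F: "finite F" "range Y \<subseteq> V.span F"
    using Y by (auto simp: finite_rank_ops_iff[OF vector_space])
  have "range (X \<circ> Y) \<subseteq> V.span (X ` F)"
    using F(2) by (auto simp: X.span_image)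
  then show ?thesis
    using F(1) X finite_rank_ops_linear[OF vector_space Y]
    by (auto intro!: finite_rank_opsI[OF vector_space, of _ "X ` F"] Vector_Spaces.linear_compose)
qed

text \<open>Although \<open>A\<close> may have infinite rank, cyclicity of the trace is applied only
  to \<open>X\<close> and \<open>A \<circ> Y\<close>, both of finite rank.\<close>

lemma trace_form_commutator:
  assumes A: "Vector_Spaces.linear scale scale A"
    and X: "X \<in> finite_rank_ops scale" and Y: "Y \<in> finite_rank_ops scale"
  shows "trace_form scale (commutator A X) Y = trace scale (A \<circ> commutator X Y)"
proof -
  interpret A: Vector_Spaces.linear scale scale A by (rule A)
  note fr = comp_finite_rank[OF vector_space] comp_finite_rank_left A X Y
    finite_rank_ops_linear[OF vector_space]
  have 1: "commutator A X \<circ> Y = (A \<circ> (X \<circ> Y)) - (X \<circ> (A \<circ> Y))"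
    by (simp add: commutator_def fun_eq_iff)
  have 2: "A \<circ> commutator X Y = (A \<circ> (X \<circ> Y)) - ((A \<circ> Y) \<circ> X)"
    by (simp add: commutator_def fun_eq_iff A.diff)
  have "trace scale (X \<circ> (A \<circ> Y)) = trace scale ((A \<circ> Y) \<circ> X)"
    by (rule trace_comp_commute[OF vector_space]) (simp_all add: fr)
  then show ?thesis
    unfolding trace_form_def 1 2 by (simp add: trace_diff[OF vector_space] fr)
qed

text \<open>Fix a nonzero \<open>w\<close> and a linear form \<phi> with
  \<open>\<phi> w = 1\<close>. For each \<open>v\<close> the rank one operator
  \<open>X u = scale (\<phi> u) v\<close> sends \<open>w\<close> to \<open>v\<close>, so
  \<open>T v = T (X w) = X (T w)\<close> is the multiple of \<open>v\<close> by
  \<open>\<phi> (T w)\<close>, a factor independent of \<open>v\<close>.\<close>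

lemma commutes_finite_rank_imp_scalar:
  assumes T: "Vector_Spaces.linear scale scale T"
    and comm: "\<And>X. X \<in> finite_rank_ops scale \<Longrightarrow> T \<circ> X = X \<circ> T"
  obtains c where "\<And>v. T v = scale c v"
proof (cases "\<exists>w::'v. w \<noteq> 0")
  case False
  then show thesis
    using that[of 0] by metis
next
  case True
  then obtain w :: 'v where w: "w \<noteq> 0" by blast
  interpret T: Vector_Spaces.linear scale scale T by (rule T)
  let ?S = "V.extend_basis {w}"
  have iw: "V.independent {w}"
    using w by simp
  have S: "V.independent ?S" "V.span ?S = UNIV" "w \<in> ?S"
    using V.independent_extend_basis[OF iw] V.span_extend_basis[OF iw]
      V.extend_basis_superset[OF iw] by auto
  define \<phi> where "\<phi> u = V.representation ?S u w" for u
  have \<phi>: "\<phi> (x + y) = \<phi> x + \<phi> y" "\<phi> (scale c x) = c * \<phi> x" "\<phi> w = 1" for x y c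
    using S by (simp_all add: \<phi>_def V.representation_add V.representation_scale V.representation_basis)
  have "T v = scale (\<phi> (T w)) v" for v
  proof -
    define X where "X u = scale (\<phi> u) v" for u
    have "Vector_Spaces.linear scale scale X"
      by (simp add: Vector_Spaces.linear_iff vector_space X_def \<phi> V.scale_left_distrib)
    then have "X \<in> finite_rank_ops scale"
      by (rule finite_rank_opsI[OF vector_space, of _ "{v}"])
        (auto simp: X_def V.span_base V.span_scale)
    then have "T (X w) = X (T w)"
      using comm[of X] by (simp add: fun_eq_iff)
    then show ?thesis
      by (simp add: X_def \<phi>)
  qed
  then show thesis by (rule that)
qed

text \<open>A nonzero eigenvalue puts all its eigenvectors in the range, and a finite dimensional
  range cannot contain an infinite independent set.\<close>

lemma finite_rank_scalar_on_independent:
  assumes F: "F \<in> finite_rank_ops scale"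
    and S: "V.independent S" "infinite S"
    and eq: "\<And>b. b \<in> S \<Longrightarrow> F b = scale c b"
  shows "c = 0"
proof (rule ccontr)
  assume c: "c \<noteq> 0"
  interpret F: Vector_Spaces.linear scale scale F
    by (rule finite_rank_ops_linear[OF vector_space F])
  obtain G where G: "finite G" "range F \<subseteq> V.span G"
    using F by (auto simp: finite_rank_ops_iff[OF vector_space])
  have "b = F (scale (inverse c) b)" if "b \<in> S" for b
    using that c by (simp add: F.scale eq)
  then have "S \<subseteq> V.span G"
    using G(2) by blast
  then show False
    using V.independent_span_bound[OF G(1) S(1)] S(2) by blast
qed

text \<open>If \<open>A = F + c\<close>, then \<open>F\<close> acts as \<open>1 - c\<close> where
  \<open>A\<close> is the identity and as \<open>- c\<close> where \<open>A\<close> vanishes. Both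
  happen on infinite independent sets, which forces \<open>c = 1\<close> and
  \<open>c = 0\<close>.\<close>

lemma exists_outer_multiplier:
  assumes "\<not> fin_dim scale UNIV"
  obtains A where "Vector_Spaces.linear scale scale A"
    and "\<And>F c. F \<in> finite_rank_ops scale \<Longrightarrow> \<not> (\<forall>v. A v = F v + scale c v)"
proof -
  define S where "S = V.extend_basis {}"
  have S: "V.independent S" "V.span S = UNIV"
    unfolding S_def using V.independent_extend_basis V.span_extend_basis V.independent_empty by auto
  then have "infinite S"
    using assms by (auto simp: fin_dim_def)
  then obtain e :: "nat \<Rightarrow> 'v" where e: "inj e" "range e \<subseteq> S"
    using infinite_countable_subset by blast
  \<comment> \<open>Even and odd indices split a sequence of distinct basis vectors into two
    disjoint infinite sets.\<close>
  let ?P = "range (\<lambda>n. e (2 * n))" and ?Q = "range (\<lambda>n. e (2 * n + 1))"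
  have inf: "infinite ?P" "infinite ?Q"
    by (auto dest!: finite_imageD injD[OF e(1)] intro!: inj_onI)
  have ind: "V.independent ?P" "V.independent ?Q"
    using e(2) by (auto intro!: V.independent_mono[OF S(1)])
  interpret VV: vector_space_pair scale scale ..
  \<comment> \<open>The projection onto the span of \<open>?P\<close> that kills the remaining basis
    vectors, in particular those in \<open>?Q\<close>.\<close>
  define A where "A = VV.construct S (\<lambda>b. if b \<in> ?P then b else 0)"
  have A: "Vector_Spaces.linear scale scale A"
    unfolding A_def by (rule VV.linear_construct[OF S(1)])
  have A_P: "A b = b" if "b \<in> ?P" for b
  proof -
    have "b \<in> S"
      using that e(2) by auto
    then show ?thesis
      using that by (simp add: A_def VV.construct_basis[OF S(1)])
  qed
  have A_Q: "A b = 0" if "b \<in> ?Q" for b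
  proof -
    have "b \<in> S" "b \<notin> ?P"
      using that e by (auto dest!: injD[OF e(1)]) presburger
    then show ?thesis
      by (simp add: A_def VV.construct_basis[OF S(1)])
  qed
  have "\<not> (\<forall>v. A v = F v + scale c v)" if F: "F \<in> finite_rank_ops scale" for F c
  proof
    assume "\<forall>v. A v = F v + scale c v"
    then have Fv: "F v = A v - scale c v" for v
      by simp
    have "1 - c = 0"
      by (rule finite_rank_scalar_on_independent[OF F ind(1) inf(1)])
        (simp add: Fv A_P V.scale_left_diff_distrib)
    moreover have "- c = 0"
      by (rule finite_rank_scalar_on_independent[OF F ind(2) inf(2)]) (simp add: Fv A_Q)
    ultimately show False by simp
  qed
  with A show thesis by (rule that)
qed

end

section \<open>An outer derivation of the finite rank operators that has a potential\<close>

theorem proposition7p4p11: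
  fixes scale :: "complex \<Rightarrow> 'v::ab_group_add \<Rightarrow> 'v"
  assumes "vector_space scale"
    and "\<not> fin_dim scale UNIV"
  shows "\<not> inj_on
    (quadratic_lie_algebra.Theta_star
      (op_scale scale) (finite_rank_ops scale) commutator (trace_form scale) 1)
    (quadratic_lie_algebra.cyclic_cohomology
      (op_scale scale) (finite_rank_ops scale) commutator (trace_form scale) 1)"
proof -
  note vs = assms(1)
  interpret V: vector_space scale by (rule vs)
  interpret Q: quadratic_lie_algebra "op_scale scale" "finite_rank_ops scale" commutator
    "trace_form scale"
    by (rule finite_rank_quadratic_lie_algebra[OF vs])
  obtain A where A: "Vector_Spaces.linear scale scale A"
    and A_outer: "\<And>F c. F \<in> finite_rank_ops scale \<Longrightarrow> \<not> (\<forall>v. A v = F v + scale c v)"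
    using exists_outer_multiplier[OF vs assms(2)] by blast
  interpret A: Vector_Spaces.linear scale scale A by (rule A)
  note AX = comp_finite_rank_left[OF vs A]
  show ?thesis
  \<comment> \<open>The goals below fix \<open>D\<close> as \<open>commutator A\<close> and
    \<open>f\<close> as the map sending \<open>Z\<close> to
    \<open>trace scale (A \<circ> Z)\<close>.\<close>
  proof (rule Q.Theta_star_1_not_inj)
    fix X Y c assume X: "X \<in> finite_rank_ops scale"
    show "commutator A X \<in> finite_rank_ops scale"
      unfolding commutator_def
      by (intro diff_finite_rank[OF vs] AX X comp_finite_rank[OF vs] A)
    have "A \<circ> op_scale scale c X = op_scale scale c (A \<circ> X)"
      by (simp add: fun_eq_iff op_scale_def A.scale)
    then show "trace scale (A \<circ> op_scale scale c X) = c * trace scale (A \<circ> X)"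
      by (simp add: trace_scale[OF vs] AX X)
    assume Y: "Y \<in> finite_rank_ops scale"
    have "A \<circ> (X + Y) = (A \<circ> X) + (A \<circ> Y)"
      by (simp add: fun_eq_iff A.add)
    then show "trace scale (A \<circ> (X + Y)) = trace scale (A \<circ> X) + trace scale (A \<circ> Y)"
      by (simp add: trace_add[OF vs] AX X Y)
    show "trace_form scale (commutator A X) Y = trace scale (A \<circ> commutator X Y)"
      by (rule trace_form_commutator[OF vs A X Y])
  next
    show "\<not> (\<exists>F\<in>finite_rank_ops scale. \<forall>X\<in>finite_rank_ops scale. commutator A X = commutator F X)"
    proof
      assume "\<exists>F\<in>finite_rank_ops scale. \<forall>X\<in>finite_rank_ops scale. commutator A X = commutator F X"
      then obtain F where F: "F \<in> finite_rank_ops scale"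
        and eq: "\<And>X. X \<in> finite_rank_ops scale \<Longrightarrow> commutator A X = commutator F X"
        by blast
      \<comment> \<open>Equal commutators with \<open>X\<close> mean that the difference commutes
        with \<open>X\<close>; it is therefore scalar, contrary to the choice of
        \<open>A\<close>.\<close>
      have "(A - F) \<circ> X = X \<circ> (A - F)" if X: "X \<in> finite_rank_ops scale" for X
      proof -
        interpret X: Vector_Spaces.linear scale scale X
          by (rule finite_rank_ops_linear[OF vs X])
        show ?thesis
          using eq[OF X] by (simp add: commutator_def fun_eq_iff X.diff algebra_simps)
      qed
      then obtain c where "\<And>v. (A - F) v = scale c v"
        using commutes_finite_rank_imp_scalar[OF vs
            linear_diff_op[OF vs A finite_rank_ops_linear[OF vs F]]] by blast
      then have "A v = F v + scale c v" for v
        by (metis add.commute diff_add_cancel minus_apply)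
      then show False
        using A_outer[OF F] by blast
    qed
  qed
qed

end
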